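(* The group ring $\mathbb{M}=\mathbb{V}G$ (as an additive abelian group), together with the scalar product $\mathbf{a}\circ X$ for $\mathbf{a}\in\mathbb{V}$, $X\in\mathbb{M}$, is a free unitary (left) $\mathbb{V}$-module with basis $$\mathfrak{B}=\{B_g=|g\rangle\langle 1_G| : g\in G\}.$$
   Context: Let $G$ be an abelian group of finite order $n$ with identity $1_G$, and let $R$ be a commutative ring with identity. For a ring $S$ with identity, the group ring $SG$ is the set of formal sums $\sum_{g\in G} a_g|g\rangle$ with $a_g\in S$, with componentwise addition and with convolution multiplication $\left(\sum_g a_g|g\rangle\right)\star\left(\sum_h b_h|h\rangle\right)=\sum_k\left(\sum_{gh=k}a_g b_h\right)|k\rangle$. Let $\mathbb{V}=RG$, a commutative ring with identity under $\star$; write $|g\rangle$ for $1_R|g\rangle\in\mathbb{V}$. Let $\mathbb{M}=\mathbb{V}G$, the set of formal sums $X=\sum_{s\in G}X_s|s\rangle$ with $X_s\in\mathbb{V}$. Elements of $\mathbb{M}$ are identified with $n\times n$ matrices over $R$ with rows and columns indexed by $G$, where $X_s$ is the column of $X$ indexed by $s$. The matrix $|j\rangle\langle k|$ has $(j,k)$-entry $1_R$ and all other entries zero; thus $B_g=|g\rangle\langle 1_G|$ is the element of $\mathbb{V}G$ whose coefficient at $1_G$ is $|g\rangle\in\mathbb{V}$ and whose other coefficients are $0$. For $\mathbf{a}=\sum_r \mathbf{a}_r|r\rangle\in\mathbb{V}$ (with $\mathbf{a}_r\in R$) and $X=\sum_s X_s|s\rangle\in\mathbb{M}$, the scalar product is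 $$\mathbf{a}\circ X=\mathbf{a}\star X=\sum_{g\in G}\Big(\sum_{rs=g}\mathbf{a}_r\star X_s\Big)|g\rangle,$$ where $\mathbf{a}_r\star X_s$ is the product in $\mathbb{V}$ with $\mathbf{a}_r\in R$ viewed as $\mathbf{a}_r|1_G\rangle\in\mathbb{V}$. A left module over a ring is required only to satisfy the two distributive laws and $(\mathbf{a}\star\mathbf{b})\circ X=\mathbf{a}\circ(\mathbf{b}\circ X)$; it is unitary if in addition $1\circ X=X$ for all $X$. It is free if it has a basis, i.e. a linearly independent subset such that every element is a linear combination of its elements with coefficients in the ring. *)

theory Defs
  imports "Jordan_Normal_Form.Missing_VectorSpace"
begin

text \<open>
  A formal sum \<open>\<Sum> a\<^sub>g |g\<rangle>\<close> is its coefficient function on \<open>carrier G\<close>, taken to be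
  \<open>undefined\<close> elsewhere so that equality of formal sums is equality of functions.
  Sums are \<open>finsum\<close>s, so these definitions are only meant for finite \<open>carrier G\<close>.
\<close>

text \<open>The single-term formal sum \<open>x |g\<rangle>\<close>.\<close>
definition gr_term :: "('r, 'm) ring_scheme \<Rightarrow> ('g, 'n) monoid_scheme \<Rightarrow> 'r \<Rightarrow> 'g \<Rightarrow> 'g \<Rightarrow> 'r" where
  "gr_term S G x g = (\<lambda>h\<in>carrier G. if h = g then x else \<zero>\<^bsub>S\<^esub>)"

definition group_ring :: "('r, 'm) ring_scheme \<Rightarrow> ('g, 'n) monoid_scheme \<Rightarrow> ('g \<Rightarrow> 'r) ring" where
  "group_ring S G =
     \<lparr>carrier = carrier G \<rightarrow>\<^sub>E carrier S,
      mult = (\<lambda>a b. \<lambda>k\<in>carrier G.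
        \<Oplus>\<^bsub>S\<^esub>p\<in>{p \<in> carrier G \<times> carrier G. fst p \<otimes>\<^bsub>G\<^esub> snd p = k}. a (fst p) \<otimes>\<^bsub>S\<^esub> b (snd p)),
      one = gr_term S G \<one>\<^bsub>S\<^esub> \<one>\<^bsub>G\<^esub>,
      zero = (\<lambda>g\<in>carrier G. \<zero>\<^bsub>S\<^esub>),
      add = (\<lambda>a b. \<lambda>g\<in>carrier G. a g \<oplus>\<^bsub>S\<^esub> b g)\<rparr>"

text \<open>
  The scalar product of \<open>a \<in> RG\<close> and \<open>X \<in> (RG)G\<close>: the convolution product in \<open>(RG)G\<close>, where
  each coefficient \<open>a\<^sub>r \<in> R\<close> is viewed as the element \<open>a\<^sub>r |1\<^sub>G\<rangle>\<close> of \<open>RG\<close>.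
\<close>
definition gr_scalar ::
  "('r, 'm) ring_scheme \<Rightarrow> ('g, 'n) monoid_scheme \<Rightarrow> ('g \<Rightarrow> 'r) \<Rightarrow> ('g \<Rightarrow> 'g \<Rightarrow> 'r) \<Rightarrow> 'g \<Rightarrow> 'g \<Rightarrow> 'r"
where
  "gr_scalar R G a X = (\<lambda>g\<in>carrier G.
     \<Oplus>\<^bsub>group_ring R G\<^esub>p\<in>{p \<in> carrier G \<times> carrier G. fst p \<otimes>\<^bsub>G\<^esub> snd p = g}.
       gr_term R G (a (fst p)) \<one>\<^bsub>G\<^esub> \<otimes>\<^bsub>group_ring R G\<^esub> X (snd p))"

definition gr_module ::
  "('r, 'm) ring_scheme \<Rightarrow> ('g, 'n) monoid_scheme \<Rightarrow> ('g \<Rightarrow> 'r, 'g \<Rightarrow> 'g \<Rightarrow> 'r) module"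
where
  "gr_module R G = ring.extend (group_ring (group_ring R G) G) \<lparr>smult = gr_scalar R G\<rparr>"

text \<open>
  The matrix unit \<open>|j\<rangle>\<langle>k|\<close>. An element \<open>X\<close> of \<open>(RG)G\<close> is read as the matrix whose column
  indexed by \<open>s\<close> is \<open>X s\<close>, so the entry in row \<open>r\<close> and column \<open>s\<close> is \<open>X s r\<close>.
\<close>
definition ket_bra ::
  "('r, 'm) ring_scheme \<Rightarrow> ('g, 'n) monoid_scheme \<Rightarrow> 'g \<Rightarrow> 'g \<Rightarrow> 'g \<Rightarrow> 'g \<Rightarrow> 'r"
where
  "ket_bra R G j k = gr_term (group_ring R G) G (gr_term R G \<one>\<^bsub>R\<^esub> j) k"

text \<open>
  \<open>LinearCombinations.module\<close> provides linear dependence and generating sets over an arbitrary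
  commutative ring, but \<open>basis\<close> is only defined there for vector spaces; this is the same
  definition for modules. The locale predicate \<open>Module.module\<close> includes the law \<open>1 \<odot> X = X\<close>,
  so all modules here are unitary.
\<close>
definition module_basis :: "('a, 'm) ring_scheme \<Rightarrow> ('a, 'c, 'n) module_scheme \<Rightarrow> 'c set \<Rightarrow> bool" where
  "module_basis A M B \<longleftrightarrow>
     B \<subseteq> carrier M \<and> \<not> LinearCombinations.module.lin_dep A M B
       \<and> LinearCombinations.module.span A M B = carrier M"

definition free_module :: "('a, 'm) ring_scheme \<Rightarrow> ('a, 'c, 'n) module_scheme \<Rightarrow> bool" where
  "free_module A M \<longleftrightarrow> Module.module A M \<and> (\<exists>B. module_basis A M B)"

end

theory Submission
  imports Defs
begin

text \<open>
  Write \<open>V\<close> for \<open>RG\<close> and read \<open>X \<in> VG\<close> as a matrix whose column \<open>s\<close> is \<open>X\<^sub>s\<close>. Its row \<open>r\<close>,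
  the function sending \<open>s\<close> to \<open>X\<^sub>s(r)\<close>, is again an element of \<open>V\<close>. In the scalar product the coefficients
  \<open>a\<^sub>t \<in> R\<close> act on the columns entrywise, so
  \<open>(a \<circ> X)\<^sub>g(r)\<close> is the sum of \<open>a\<^sub>t X\<^sub>s(r)\<close> over all \<open>t s = g\<close>,
  which says that row \<open>r\<close> of \<open>a \<circ> X\<close> is the convolution of \<open>a\<close> with row \<open>r\<close> of \<open>X\<close>
  (\<open>row_gr_scalar\<close>). Reading matrices by rows therefore identifies \<open>VG\<close> with the module of
  functions from \<open>G\<close> to \<open>V\<close> on which \<open>V\<close> acts by multiplication in each coordinate. The unitary module laws
  are then the ring laws of \<open>V\<close>, taken row by row, and these in turn hold because convolution makes
  \<open>RG\<close> a commutative ring (\<open>cring_group_ring\<close>).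

  The rows of \<open>B\<^sub>g\<close> all vanish except row \<open>g\<close>, which is the identity of \<open>V\<close> (\<open>row_ket_bra\<close>). So the
  \<open>B\<^sub>g\<close> are the coordinate vectors of that function module, and the coefficient of \<open>B\<^sub>g\<close> in a linear
  combination is row \<open>g\<close> of the result (\<open>row_lincomb\<close>). Linear independence and generation both
  follow from this. If \<open>R\<close> is the zero ring, the \<open>B\<^sub>g\<close> coincide and the basis is the singleton of the
  zero vector; this is independent because the only available coefficient is zero.
\<close>

section \<open>The group ring of a finite group\<close>

locale finite_group_ring = R: ring R + G: group G
  for R :: "('r, 'm) ring_scheme" (structure) and G :: "('g, 'n) monoid_scheme" +
  assumes finite_carrier: "finite (carrier G)"
begin

lemma carrier_group_ring: "carrier (group_ring R G) = carrier G \<rightarrow>\<^sub>E carrier R"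
  by (simp add: group_ring_def)

lemma group_ring_apply_closed:
  assumes "a \<in> carrier (group_ring R G)" "g \<in> carrier G"
  shows "a g \<in> carrier R"
  using assms by (auto simp: carrier_group_ring)

lemma group_ring_eqI:
  assumes "a \<in> carrier (group_ring R G)" "b \<in> carrier (group_ring R G)"
    and "\<And>g. g \<in> carrier G \<Longrightarrow> a g = b g"
  shows "a = b"
  using assms unfolding carrier_group_ring by (rule PiE_ext)

lemma zero_apply: "g \<in> carrier G \<Longrightarrow> \<zero>\<^bsub>group_ring R G\<^esub> g = \<zero>"
  by (simp add: group_ring_def)

lemma add_apply: "g \<in> carrier G \<Longrightarrow> (a \<oplus>\<^bsub>group_ring R G\<^esub> b) g = a g \<oplus> b g"
  by (simp add: group_ring_def)

lemma term_apply: "h \<in> carrier G \<Longrightarrow> gr_term R G x g h = (if h = g then x else \<zero>)"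
  by (simp add: gr_term_def)

lemma one_eq_term: "\<one>\<^bsub>group_ring R G\<^esub> = gr_term R G \<one> \<one>\<^bsub>G\<^esub>"
  by (simp add: group_ring_def)

lemma term_closed: "x \<in> carrier R \<Longrightarrow> gr_term R G x g \<in> carrier (group_ring R G)"
  by (auto simp: carrier_group_ring gr_term_def)

lemma zero_closed: "\<zero>\<^bsub>group_ring R G\<^esub> \<in> carrier (group_ring R G)"
  by (simp add: group_ring_def)

lemma add_closed:
  assumes "a \<in> carrier (group_ring R G)" "b \<in> carrier (group_ring R G)"
  shows "a \<oplus>\<^bsub>group_ring R G\<^esub> b \<in> carrier (group_ring R G)"
  using assms by (auto simp: group_ring_def intro!: R.add.m_closed)

lemma abelian_group_group_ring: "abelian_group (group_ring R G)"
proof (rule abelian_groupI)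
  note simps = add_apply zero_apply add_closed zero_closed group_ring_apply_closed
  show "\<exists>y\<in>carrier (group_ring R G). y \<oplus>\<^bsub>group_ring R G\<^esub> x = \<zero>\<^bsub>group_ring R G\<^esub>"
    if x: "x \<in> carrier (group_ring R G)" for x
  proof
    show neg: "(\<lambda>g\<in>carrier G. \<ominus> x g) \<in> carrier (group_ring R G)"
      using x by (auto simp: carrier_group_ring)
    show "(\<lambda>g\<in>carrier G. \<ominus> x g) \<oplus>\<^bsub>group_ring R G\<^esub> x = \<zero>\<^bsub>group_ring R G\<^esub>"
      using neg x by (intro group_ring_eqI) (simp_all add: simps R.l_neg)
  qed
  show "a \<oplus>\<^bsub>group_ring R G\<^esub> b \<oplus>\<^bsub>group_ring R G\<^esub> c
      = a \<oplus>\<^bsub>group_ring R G\<^esub> (b \<oplus>\<^bsub>group_ring R G\<^esub> c)"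
    if "a \<in> carrier (group_ring R G)" "b \<in> carrier (group_ring R G)" "c \<in> carrier (group_ring R G)"
    for a b c
    using that by (intro group_ring_eqI) (simp_all add: simps R.a_assoc)
  show "a \<oplus>\<^bsub>group_ring R G\<^esub> b = b \<oplus>\<^bsub>group_ring R G\<^esub> a"
    if "a \<in> carrier (group_ring R G)" "b \<in> carrier (group_ring R G)" for a b
    using that by (intro group_ring_eqI) (simp_all add: simps R.a_comm)
  show "\<zero>\<^bsub>group_ring R G\<^esub> \<oplus>\<^bsub>group_ring R G\<^esub> a = a" if "a \<in> carrier (group_ring R G)" for a
    using that by (intro group_ring_eqI) (simp_all add: simps)
qed (simp_all add: add_closed zero_closed)

sublocale add: abelian_group "group_ring R G"
  by (rule abelian_group_group_ring)

text \<open>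
  Addition is coordinatewise, so the iterated sums inside the scalar product and inside linear
  combinations can be computed one coordinate at a time.
\<close>
lemma finsum_apply:
  assumes "f \<in> A \<rightarrow> carrier (group_ring R G)" "g \<in> carrier G"
  shows "(\<Oplus>\<^bsub>group_ring R G\<^esub>i\<in>A. f i) g = (\<Oplus>i\<in>A. f i g)"
  using assms
proof (induction A rule: infinite_finite_induct)
  case (insert i A)
  then have "f i \<in> carrier (group_ring R G)" "f \<in> A \<rightarrow> carrier (group_ring R G)"
    "(\<lambda>i. f i g) \<in> A \<rightarrow> carrier R"
    by (auto intro!: group_ring_apply_closed)
  with insert show ?case
    by (simp add: add.finsum_insert R.finsum_insert add_apply group_ring_apply_closed)
qed (simp_all add: add.finsum_infinite R.finsum_infinite zero_apply)

text \<open>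
  Solving \<open>g h = k\<close> for \<open>h\<close> turns the sum over factorisations into a sum over the group, whose
  index set does not depend on \<open>k\<close>; double sums can then be interchanged.
\<close>
lemma finsum_factorisations:
  assumes k: "k \<in> carrier G" and f: "\<And>g h. g \<in> carrier G \<Longrightarrow> h \<in> carrier G \<Longrightarrow> f g h \<in> carrier R"
  shows "(\<Oplus>p\<in>{p \<in> carrier G \<times> carrier G. fst p \<otimes>\<^bsub>G\<^esub> snd p = k}. f (fst p) (snd p))
    = (\<Oplus>g\<in>carrier G. f g (inv\<^bsub>G\<^esub> g \<otimes>\<^bsub>G\<^esub> k))"
proof -
  let ?h = "\<lambda>g. (g, inv\<^bsub>G\<^esub> g \<otimes>\<^bsub>G\<^esub> k)"
  have image: "{p \<in> carrier G \<times> carrier G. fst p \<otimes>\<^bsub>G\<^esub> snd p = k} = ?h ` carrier G"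
    using k by (auto simp: image_iff G.m_assoc[symmetric])
  have "inj_on ?h (carrier G)"
    by (rule inj_onI) simp
  then have "(\<Oplus>p\<in>?h ` carrier G. f (fst p) (snd p)) = (\<Oplus>g\<in>carrier G. f (fst (?h g)) (snd (?h g)))"
    using k f by (intro R.finsum_reindex) auto
  then show ?thesis
    by (simp add: image)
qed

lemma mult_apply:
  assumes "a \<in> carrier (group_ring R G)" "b \<in> carrier (group_ring R G)" "k \<in> carrier G"
  shows "(a \<otimes>\<^bsub>group_ring R G\<^esub> b) k = (\<Oplus>g\<in>carrier G. a g \<otimes> b (inv\<^bsub>G\<^esub> g \<otimes>\<^bsub>G\<^esub> k))"
  using finsum_factorisations[of k "\<lambda>g h. a g \<otimes> b h"] assms
  by (simp add: group_ring_apply_closed) (simp add: group_ring_def)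

lemma mult_closed:
  assumes "a \<in> carrier (group_ring R G)" "b \<in> carrier (group_ring R G)"
  shows "a \<otimes>\<^bsub>group_ring R G\<^esub> b \<in> carrier (group_ring R G)"
proof -
  have "(a \<otimes>\<^bsub>group_ring R G\<^esub> b) k \<in> carrier R" if "k \<in> carrier G" for k
    using that assms by (auto simp: mult_apply group_ring_apply_closed intro!: R.finsum_closed)
  moreover have "a \<otimes>\<^bsub>group_ring R G\<^esub> b \<in> extensional (carrier G)"
    by (simp add: group_ring_def)
  ultimately show ?thesis
    by (auto simp: carrier_group_ring PiE_def)
qed

end

lemma (in abelian_monoid) finsum_swap:
  assumes "finite A" "\<And>i j. i \<in> A \<Longrightarrow> j \<in> B \<Longrightarrow> f i j \<in> carrier G"
  shows "(\<Oplus>i\<in>A. \<Oplus>j\<in>B. f i j) = (\<Oplus>j\<in>B. \<Oplus>i\<in>A. f i j)"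
  using assms
proof (induction A rule: finite_induct)
  case (insert i A)
  have closed: "(\<lambda>j. f i j) \<in> B \<rightarrow> carrier G" "(\<lambda>j. \<Oplus>i\<in>A. f i j) \<in> B \<rightarrow> carrier G"
    "(\<lambda>i. \<Oplus>j\<in>B. f i j) \<in> A \<rightarrow> carrier G"
    using insert.prems by (auto intro!: finsum_closed)
  have "(\<Oplus>j\<in>B. \<Oplus>i\<in>insert i A. f i j) = (\<Oplus>j\<in>B. f i j \<oplus> (\<Oplus>i\<in>A. f i j))"
    using insert closed by (intro finsum_cong') (auto simp: Pi_def)
  then show ?case
    using insert closed by (simp add: finsum_addf)
qed simp

context finite_group_ring
begin

text \<open>
  Both bracketings are double sums over \<open>(t, u)\<close>; after interchanging the summations, the inner
  index \<open>u\<close>, the product of the first two group elements, is replaced by the second element itself.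
\<close>
lemma mult_assoc:
  assumes a: "a \<in> carrier (group_ring R G)" and b: "b \<in> carrier (group_ring R G)"
    and c: "c \<in> carrier (group_ring R G)"
  shows "(a \<otimes>\<^bsub>group_ring R G\<^esub> b) \<otimes>\<^bsub>group_ring R G\<^esub> c
    = a \<otimes>\<^bsub>group_ring R G\<^esub> (b \<otimes>\<^bsub>group_ring R G\<^esub> c)"
proof (rule group_ring_eqI)
  fix k assume k: "k \<in> carrier G"
  note closed [simp] = a b c k mult_closed group_ring_apply_closed
  have "((a \<otimes>\<^bsub>group_ring R G\<^esub> b) \<otimes>\<^bsub>group_ring R G\<^esub> c) k
      = (\<Oplus>u\<in>carrier G. (\<Oplus>t\<in>carrier G. a t \<otimes> b (inv\<^bsub>G\<^esub> t \<otimes>\<^bsub>G\<^esub> u)) \<otimes> c (inv\<^bsub>G\<^esub> u \<otimes>\<^bsub>G\<^esub> k))"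
    by (auto simp: mult_apply intro!: R.finsum_cong' R.finsum_closed)
  also have "\<dots> = (\<Oplus>u\<in>carrier G. \<Oplus>t\<in>carrier G.
      a t \<otimes> b (inv\<^bsub>G\<^esub> t \<otimes>\<^bsub>G\<^esub> u) \<otimes> c (inv\<^bsub>G\<^esub> u \<otimes>\<^bsub>G\<^esub> k))"
    using finite_carrier by (auto simp: R.finsum_ldistr Pi_def intro!: R.finsum_cong' R.finsum_closed)
  also have "\<dots> = (\<Oplus>t\<in>carrier G. \<Oplus>u\<in>carrier G.
      a t \<otimes> b (inv\<^bsub>G\<^esub> t \<otimes>\<^bsub>G\<^esub> u) \<otimes> c (inv\<^bsub>G\<^esub> u \<otimes>\<^bsub>G\<^esub> k))"
    using finite_carrier by (intro R.finsum_swap) auto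
  also have "\<dots> = (\<Oplus>t\<in>carrier G. \<Oplus>v\<in>carrier G.
      a t \<otimes> (b v \<otimes> c (inv\<^bsub>G\<^esub> v \<otimes>\<^bsub>G\<^esub> (inv\<^bsub>G\<^esub> t \<otimes>\<^bsub>G\<^esub> k))))"
  proof (rule R.finsum_cong'[OF refl])
    fix t assume t: "t \<in> carrier G"
    let ?F = "\<lambda>u. a t \<otimes> b (inv\<^bsub>G\<^esub> t \<otimes>\<^bsub>G\<^esub> u) \<otimes> c (inv\<^bsub>G\<^esub> u \<otimes>\<^bsub>G\<^esub> k)"
    \<comment> \<open>Left translation \<open>u = t v\<close> permutes the group.\<close>
    have "(\<Oplus>u\<in>(\<lambda>v. t \<otimes>\<^bsub>G\<^esub> v) ` carrier G. ?F u) = (\<Oplus>v\<in>carrier G. ?F (t \<otimes>\<^bsub>G\<^esub> v))"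
      using t by (intro R.finsum_reindex) (auto simp: G.inj_on_cmult)
    then have "(\<Oplus>u\<in>carrier G. ?F u) = (\<Oplus>v\<in>carrier G. ?F (t \<otimes>\<^bsub>G\<^esub> v))"
      using t by (simp add: G.surj_const_mult)
    also have "\<dots> = (\<Oplus>v\<in>carrier G. a t \<otimes> (b v \<otimes> c (inv\<^bsub>G\<^esub> v \<otimes>\<^bsub>G\<^esub> (inv\<^bsub>G\<^esub> t \<otimes>\<^bsub>G\<^esub> k))))"
      using t
      by (auto simp: R.m_assoc G.inv_mult_group G.m_assoc[symmetric] intro!: R.finsum_cong')
    finally show "(\<Oplus>u\<in>carrier G. ?F u) = \<dots>" .
  qed (auto intro!: R.finsum_closed)
  also have "\<dots> = (\<Oplus>t\<in>carrier G. a t \<otimes>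
      (\<Oplus>v\<in>carrier G. b v \<otimes> c (inv\<^bsub>G\<^esub> v \<otimes>\<^bsub>G\<^esub> (inv\<^bsub>G\<^esub> t \<otimes>\<^bsub>G\<^esub> k))))"
    using finite_carrier by (auto simp: R.finsum_rdistr Pi_def intro!: R.finsum_cong' R.finsum_closed)
  also have "\<dots> = (a \<otimes>\<^bsub>group_ring R G\<^esub> (b \<otimes>\<^bsub>group_ring R G\<^esub> c)) k"
    by (auto simp: mult_apply intro!: R.finsum_cong' R.finsum_closed)
  finally show "((a \<otimes>\<^bsub>group_ring R G\<^esub> b) \<otimes>\<^bsub>group_ring R G\<^esub> c) k
      = (a \<otimes>\<^bsub>group_ring R G\<^esub> (b \<otimes>\<^bsub>group_ring R G\<^esub> c)) k" .
qed (use assms mult_closed in auto)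

text \<open>
  Only one summand of the convolution survives, the factorisation \<open>k = 1 k\<close>. Thus multiplying
  by a scalar embedded at the identity is entrywise multiplication, as it is used inside
  the scalar product on matrices.
\<close>
lemma term_one_mult_apply:
  assumes "x \<in> carrier R" "b \<in> carrier (group_ring R G)" "k \<in> carrier G"
  shows "(gr_term R G x \<one>\<^bsub>G\<^esub> \<otimes>\<^bsub>group_ring R G\<^esub> b) k = x \<otimes> b k"
proof -
  have "(gr_term R G x \<one>\<^bsub>G\<^esub> \<otimes>\<^bsub>group_ring R G\<^esub> b) k
      = (\<Oplus>g\<in>carrier G. if \<one>\<^bsub>G\<^esub> = g then x \<otimes> b (inv\<^bsub>G\<^esub> g \<otimes>\<^bsub>G\<^esub> k) else \<zero>)"
    using assms
    by (auto simp: mult_apply term_closed term_apply group_ring_apply_closed intro!: R.finsum_cong')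
  also have "\<dots> = x \<otimes> b (inv\<^bsub>G\<^esub> \<one>\<^bsub>G\<^esub> \<otimes>\<^bsub>G\<^esub> k)"
    using assms finite_carrier by (intro R.finsum_singleton) (auto simp: group_ring_apply_closed)
  finally show ?thesis
    using assms by simp
qed

lemma one_closed: "\<one>\<^bsub>group_ring R G\<^esub> \<in> carrier (group_ring R G)"
  by (simp add: one_eq_term term_closed)

lemma mult_one_left:
  assumes "a \<in> carrier (group_ring R G)"
  shows "\<one>\<^bsub>group_ring R G\<^esub> \<otimes>\<^bsub>group_ring R G\<^esub> a = a"
  using assms
  by (intro group_ring_eqI)
     (simp_all add: mult_closed one_closed term_closed one_eq_term term_one_mult_apply group_ring_apply_closed)

lemma mult_one_right:
  assumes a: "a \<in> carrier (group_ring R G)"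
  shows "a \<otimes>\<^bsub>group_ring R G\<^esub> \<one>\<^bsub>group_ring R G\<^esub> = a"
proof (rule group_ring_eqI)
  fix k assume k: "k \<in> carrier G"
  have "(a \<otimes>\<^bsub>group_ring R G\<^esub> \<one>\<^bsub>group_ring R G\<^esub>) k = (\<Oplus>g\<in>carrier G. if k = g then a g else \<zero>)"
    unfolding mult_apply[OF a one_closed k]
  proof (rule R.finsum_cong'[OF refl])
    fix g assume g: "g \<in> carrier G"
    have "inv\<^bsub>G\<^esub> g \<otimes>\<^bsub>G\<^esub> k = \<one>\<^bsub>G\<^esub> \<longleftrightarrow> k = g"
      using g k G.inv_solve_left'[of "\<one>\<^bsub>G\<^esub>" g k] by auto
    then show "a g \<otimes> \<one>\<^bsub>group_ring R G\<^esub> (inv\<^bsub>G\<^esub> g \<otimes>\<^bsub>G\<^esub> k) = (if k = g then a g else \<zero>)"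
      using a g k by (simp add: one_eq_term term_apply group_ring_apply_closed)
  qed (use a in \<open>auto simp: group_ring_apply_closed\<close>)
  also have "\<dots> = a k"
    using a k finite_carrier by (intro R.finsum_singleton) (auto simp: group_ring_apply_closed)
  finally show "(a \<otimes>\<^bsub>group_ring R G\<^esub> \<one>\<^bsub>group_ring R G\<^esub>) k = a k" .
qed (use a one_closed mult_closed in auto)

lemma mult_add_left:
  assumes a: "a \<in> carrier (group_ring R G)" and b: "b \<in> carrier (group_ring R G)"
    and c: "c \<in> carrier (group_ring R G)"
  shows "(a \<oplus>\<^bsub>group_ring R G\<^esub> b) \<otimes>\<^bsub>group_ring R G\<^esub> c
    = a \<otimes>\<^bsub>group_ring R G\<^esub> c \<oplus>\<^bsub>group_ring R G\<^esub> b \<otimes>\<^bsub>group_ring R G\<^esub> c"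
proof (rule group_ring_eqI)
  fix k assume k: "k \<in> carrier G"
  note closed [simp] = a b c k mult_closed add_closed group_ring_apply_closed
  have "((a \<oplus>\<^bsub>group_ring R G\<^esub> b) \<otimes>\<^bsub>group_ring R G\<^esub> c) k
      = (\<Oplus>g\<in>carrier G. a g \<otimes> c (inv\<^bsub>G\<^esub> g \<otimes>\<^bsub>G\<^esub> k) \<oplus> b g \<otimes> c (inv\<^bsub>G\<^esub> g \<otimes>\<^bsub>G\<^esub> k))"
    unfolding mult_apply[OF add_closed[OF a b] c k]
    by (rule R.finsum_cong') (auto simp: add_apply R.l_distr)
  also have "\<dots> = (a \<otimes>\<^bsub>group_ring R G\<^esub> c) k \<oplus> (b \<otimes>\<^bsub>group_ring R G\<^esub> c) k"
    unfolding mult_apply[OF a c k] mult_apply[OF b c k]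
    by (rule R.finsum_addf) auto
  finally show "((a \<oplus>\<^bsub>group_ring R G\<^esub> b) \<otimes>\<^bsub>group_ring R G\<^esub> c) k
      = (a \<otimes>\<^bsub>group_ring R G\<^esub> c \<oplus>\<^bsub>group_ring R G\<^esub> b \<otimes>\<^bsub>group_ring R G\<^esub> c) k"
    by (simp add: add_apply)
qed (use assms mult_closed add_closed in auto)

lemma mult_add_right:
  assumes a: "a \<in> carrier (group_ring R G)" and b: "b \<in> carrier (group_ring R G)"
    and c: "c \<in> carrier (group_ring R G)"
  shows "c \<otimes>\<^bsub>group_ring R G\<^esub> (a \<oplus>\<^bsub>group_ring R G\<^esub> b)
    = c \<otimes>\<^bsub>group_ring R G\<^esub> a \<oplus>\<^bsub>group_ring R G\<^esub> c \<otimes>\<^bsub>group_ring R G\<^esub> b"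
proof (rule group_ring_eqI)
  fix k assume k: "k \<in> carrier G"
  note closed [simp] = a b c k mult_closed add_closed group_ring_apply_closed
  have "(c \<otimes>\<^bsub>group_ring R G\<^esub> (a \<oplus>\<^bsub>group_ring R G\<^esub> b)) k
      = (\<Oplus>g\<in>carrier G. c g \<otimes> a (inv\<^bsub>G\<^esub> g \<otimes>\<^bsub>G\<^esub> k) \<oplus> c g \<otimes> b (inv\<^bsub>G\<^esub> g \<otimes>\<^bsub>G\<^esub> k))"
    unfolding mult_apply[OF c add_closed[OF a b] k]
    by (rule R.finsum_cong') (auto simp: add_apply R.r_distr)
  also have "\<dots> = (c \<otimes>\<^bsub>group_ring R G\<^esub> a) k \<oplus> (c \<otimes>\<^bsub>group_ring R G\<^esub> b) k"
    unfolding mult_apply[OF c a k] mult_apply[OF c b k]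
    by (rule R.finsum_addf) auto
  finally show "(c \<otimes>\<^bsub>group_ring R G\<^esub> (a \<oplus>\<^bsub>group_ring R G\<^esub> b)) k
      = (c \<otimes>\<^bsub>group_ring R G\<^esub> a \<oplus>\<^bsub>group_ring R G\<^esub> c \<otimes>\<^bsub>group_ring R G\<^esub> b) k"
    by (simp add: add_apply)
qed (use assms mult_closed add_closed in auto)

lemma ring_group_ring: "ring (group_ring R G)"
  by (intro ringI monoidI abelian_group_group_ring)
     (simp_all add: mult_closed one_closed mult_assoc mult_one_left mult_one_right
       mult_add_left mult_add_right)

end

locale finite_comm_group_ring = R: cring R + G: comm_group G
  for R :: "('r, 'm) ring_scheme" (structure) and G :: "('g, 'n) monoid_scheme" +
  assumes finite_carrier: "finite (carrier G)"
begin

sublocale V: finite_group_ring R G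
  by unfold_locales (rule finite_carrier)

lemma mult_commute:
  assumes "a \<in> carrier (group_ring R G)" "b \<in> carrier (group_ring R G)"
  shows "a \<otimes>\<^bsub>group_ring R G\<^esub> b = b \<otimes>\<^bsub>group_ring R G\<^esub> a"
proof (rule V.group_ring_eqI)
  fix k assume k: "k \<in> carrier G"
  let ?P = "{p \<in> carrier G \<times> carrier G. fst p \<otimes>\<^bsub>G\<^esub> snd p = k}"
  have image: "?P = prod.swap ` ?P"
    by (auto simp: image_iff G.m_comm)
  have "(\<Oplus>p\<in>prod.swap ` ?P. a (fst p) \<otimes> b (snd p)) = (\<Oplus>p\<in>?P. b (fst p) \<otimes> a (snd p))"
    using assms
    by (subst R.finsum_reindex)
       (auto simp: V.group_ring_apply_closed R.m_comm intro!: R.finsum_cong')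
  then show "(a \<otimes>\<^bsub>group_ring R G\<^esub> b) k = (b \<otimes>\<^bsub>group_ring R G\<^esub> a) k"
    using k by (simp add: group_ring_def image[symmetric])
qed (use assms V.mult_closed in auto)

lemma cring_group_ring: "cring (group_ring R G)"
  by (intro cring.intro comm_monoid.intro ring.is_monoid V.ring_group_ring comm_monoid_axioms.intro mult_commute)

sublocale V: cring "group_ring R G"
  by (rule cring_group_ring)

section \<open>The module, one row at a time\<close>

sublocale M: finite_group_ring "group_ring R G" G
  by unfold_locales (rule finite_carrier)

text \<open>
  Matrices are stored by columns; a row is restricted to \<open>carrier G\<close> so that it is itself a formal
  sum in \<open>RG\<close>.
\<close>
definition row :: "('g \<Rightarrow> 'g \<Rightarrow> 'r) \<Rightarrow> 'g \<Rightarrow> 'g \<Rightarrow> 'r" where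
  "row X r = (\<lambda>s\<in>carrier G. X s r)"

lemma gr_module_simps:
  "carrier (gr_module R G) = carrier (group_ring (group_ring R G) G)"
  "\<zero>\<^bsub>gr_module R G\<^esub> = \<zero>\<^bsub>group_ring (group_ring R G) G\<^esub>"
  "X \<oplus>\<^bsub>gr_module R G\<^esub> Y = X \<oplus>\<^bsub>group_ring (group_ring R G) G\<^esub> Y"
  "a \<odot>\<^bsub>gr_module R G\<^esub> X = gr_scalar R G a X"
  "finsum (gr_module R G) = finsum (group_ring (group_ring R G) G)"
  by (simp_all add: gr_module_def ring.defs finsum_def finprod_def fun_eq_iff)

lemma row_closed:
  assumes "X \<in> carrier (group_ring (group_ring R G) G)" "r \<in> carrier G"
  shows "row X r \<in> carrier (group_ring R G)"
  using assms by (auto simp: row_def V.carrier_group_ring M.carrier_group_ring)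

lemma row_eqI:
  assumes "X \<in> carrier (group_ring (group_ring R G) G)" "Y \<in> carrier (group_ring (group_ring R G) G)"
    and rows: "\<And>r. r \<in> carrier G \<Longrightarrow> row X r = row Y r"
  shows "X = Y"
proof (intro M.group_ring_eqI V.group_ring_eqI)
  show "X s r = Y s r" if "s \<in> carrier G" "r \<in> carrier G" for s r
    using fun_cong[OF rows[of r], of s] that by (simp add: row_def)
qed (use assms M.group_ring_apply_closed in auto)

lemma row_zero:
  "r \<in> carrier G \<Longrightarrow> row \<zero>\<^bsub>group_ring (group_ring R G) G\<^esub> r = \<zero>\<^bsub>group_ring R G\<^esub>"
  by (simp add: row_def group_ring_def cong: restrict_cong)

lemma row_add:
  "r \<in> carrier G \<Longrightarrow>
    row (X \<oplus>\<^bsub>group_ring (group_ring R G) G\<^esub> Y) r = row X r \<oplus>\<^bsub>group_ring R G\<^esub> row Y r"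
  by (simp add: row_def group_ring_def cong: restrict_cong)

lemma row_finsum:
  assumes "f \<in> A \<rightarrow> carrier (group_ring (group_ring R G) G)" "r \<in> carrier G"
  shows "row (\<Oplus>\<^bsub>group_ring (group_ring R G) G\<^esub>i\<in>A. f i) r = (\<Oplus>\<^bsub>group_ring R G\<^esub>i\<in>A. row (f i) r)"
proof (rule V.group_ring_eqI)
  have rows: "(\<lambda>i. row (f i) r) \<in> A \<rightarrow> carrier (group_ring R G)"
    using assms by (auto intro!: row_closed)
  then show "(\<Oplus>\<^bsub>group_ring R G\<^esub>i\<in>A. row (f i) r) \<in> carrier (group_ring R G)"
    by (rule V.add.finsum_closed)
  show "row (\<Oplus>\<^bsub>group_ring (group_ring R G) G\<^esub>i\<in>A. f i) r \<in> carrier (group_ring R G)"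
    using assms by (intro row_closed M.add.finsum_closed)
  fix s assume s: "s \<in> carrier G"
  have "(\<lambda>i. f i s) \<in> A \<rightarrow> carrier (group_ring R G)"
    using assms s by (auto intro!: M.group_ring_apply_closed)
  then show "row (\<Oplus>\<^bsub>group_ring (group_ring R G) G\<^esub>i\<in>A. f i) r s = (\<Oplus>\<^bsub>group_ring R G\<^esub>i\<in>A. row (f i) r) s"
    using assms s rows by (simp add: row_def M.finsum_apply V.finsum_apply)
qed

lemma gr_scalar_summand_closed:
  assumes "a \<in> carrier (group_ring R G)" "X \<in> carrier (group_ring (group_ring R G) G)"
    and "g \<in> carrier G" "h \<in> carrier G"
  shows "gr_term R G (a g) \<one>\<^bsub>G\<^esub> \<otimes>\<^bsub>group_ring R G\<^esub> X h \<in> carrier (group_ring R G)"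
  using assms V.group_ring_apply_closed[of a g] M.group_ring_apply_closed[of X h]
  by (intro V.mult_closed V.term_closed)

lemma gr_scalar_closed:
  assumes "a \<in> carrier (group_ring R G)" "X \<in> carrier (group_ring (group_ring R G) G)"
  shows "gr_scalar R G a X \<in> carrier (group_ring (group_ring R G) G)"
  using assms
  by (auto simp: M.carrier_group_ring gr_scalar_def
      intro!: V.add.finsum_closed gr_scalar_summand_closed[unfolded M.carrier_group_ring])

text \<open>
  This identity reduces the module to the ring. The coefficients of \<open>a\<close> scale columns of \<open>X\<close>, move
  them and add them up, and each of these operations treats the rows separately; within one row the
  sum over \<open>t s = g\<close> is exactly the one that defines multiplication in \<open>RG\<close>.
\<close>
lemma row_gr_scalar:
  assumes a: "a \<in> carrier (group_ring R G)" and X: "X \<in> carrier (group_ring (group_ring R G) G)"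
    and r: "r \<in> carrier G"
  shows "row (gr_scalar R G a X) r = a \<otimes>\<^bsub>group_ring R G\<^esub> row X r"
proof (rule V.group_ring_eqI)
  fix k assume k: "k \<in> carrier G"
  let ?P = "{p \<in> carrier G \<times> carrier G. fst p \<otimes>\<^bsub>G\<^esub> snd p = k}"
  have "row (gr_scalar R G a X) r k
      = (\<Oplus>p\<in>?P. (gr_term R G (a (fst p)) \<one>\<^bsub>G\<^esub> \<otimes>\<^bsub>group_ring R G\<^esub> X (snd p)) r)"
    using a X k r by (auto simp: row_def gr_scalar_def intro!: V.finsum_apply gr_scalar_summand_closed)
  also have "\<dots> = (\<Oplus>p\<in>?P. a (fst p) \<otimes> row X r (snd p))"
    using a X k r
    by (auto simp: V.term_one_mult_apply V.group_ring_apply_closed M.group_ring_apply_closed row_def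
        intro!: R.finsum_cong')
  also have "\<dots> = (a \<otimes>\<^bsub>group_ring R G\<^esub> row X r) k"
    using k by (simp add: group_ring_def)
  finally show "row (gr_scalar R G a X) r k = (a \<otimes>\<^bsub>group_ring R G\<^esub> row X r) k" .
qed (use assms gr_scalar_closed row_closed in auto)

lemma abelian_group_gr_module: "abelian_group (gr_module R G)"
proof (rule abelian_groupI, unfold gr_module_simps)
  show "\<exists>Y\<in>carrier (group_ring (group_ring R G) G).
      Y \<oplus>\<^bsub>group_ring (group_ring R G) G\<^esub> X = \<zero>\<^bsub>group_ring (group_ring R G) G\<^esub>"
    if "X \<in> carrier (group_ring (group_ring R G) G)" for X
    using M.add.l_neg[OF that] M.add.a_inv_closed[OF that] by blast
qed (simp_all add: M.add.a_ac)

lemma module_gr_module: "Module.module (group_ring R G) (gr_module R G)"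
proof (rule moduleI, unfold gr_module_simps)
  note closed = gr_scalar_closed row_closed M.add_closed V.add_closed V.mult_closed V.one_closed
  note row = row_gr_scalar row_add
  show "gr_scalar R G (a \<oplus>\<^bsub>group_ring R G\<^esub> b) X
      = gr_scalar R G a X \<oplus>\<^bsub>group_ring (group_ring R G) G\<^esub> gr_scalar R G b X"
    if "a \<in> carrier (group_ring R G)" "b \<in> carrier (group_ring R G)"
      "X \<in> carrier (group_ring (group_ring R G) G)" for a b X
    using that by (intro row_eqI) (simp_all add: closed row V.mult_add_left)
  show "gr_scalar R G a (X \<oplus>\<^bsub>group_ring (group_ring R G) G\<^esub> Y)
      = gr_scalar R G a X \<oplus>\<^bsub>group_ring (group_ring R G) G\<^esub> gr_scalar R G a Y"
    if "a \<in> carrier (group_ring R G)" "X \<in> carrier (group_ring (group_ring R G) G)"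
      "Y \<in> carrier (group_ring (group_ring R G) G)" for a X Y
    using that by (intro row_eqI) (simp_all add: closed row V.mult_add_right)
  show "gr_scalar R G (a \<otimes>\<^bsub>group_ring R G\<^esub> b) X = gr_scalar R G a (gr_scalar R G b X)"
    if "a \<in> carrier (group_ring R G)" "b \<in> carrier (group_ring R G)"
      "X \<in> carrier (group_ring (group_ring R G) G)" for a b X
    using that by (intro row_eqI) (simp_all add: closed row V.mult_assoc)
  show "gr_scalar R G \<one>\<^bsub>group_ring R G\<^esub> X = X"
    if "X \<in> carrier (group_ring (group_ring R G) G)" for X
    using that by (intro row_eqI) (simp_all add: closed row V.mult_one_left)
qed (simp_all add: cring_group_ring abelian_group_gr_module gr_scalar_closed)

sublocale M: Module.module "group_ring R G" "gr_module R G"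
  rewrites "carrier (gr_module R G) = carrier (group_ring (group_ring R G) G)"
  by (rule module_gr_module) (rule gr_module_simps)

section \<open>The matrix units of the first column\<close>

lemma ket_bra_closed: "ket_bra R G g k \<in> carrier (group_ring (group_ring R G) G)"
  by (simp add: ket_bra_def M.term_closed V.term_closed)

lemma row_ket_bra:
  assumes "r \<in> carrier G"
  shows "row (ket_bra R G g \<one>\<^bsub>G\<^esub>) r = (if r = g then \<one>\<^bsub>group_ring R G\<^esub> else \<zero>\<^bsub>group_ring R G\<^esub>)"
  using assms
  by (auto simp: row_def ket_bra_def gr_term_def group_ring_def intro!: restrict_ext)

abbreviation first_column_units :: "('g \<Rightarrow> 'g \<Rightarrow> 'r) set" where
  "first_column_units \<equiv> {ket_bra R G g \<one>\<^bsub>G\<^esub> | g. g \<in> carrier G}"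

text \<open>
  In row \<open>r\<close> every unit of \<open>A\<close> other than \<open>B\<^sub>r\<close> contributes zero, and \<open>B\<^sub>r\<close> contributes its coefficient.
  The sum ranges over the set of units and not over their indices, so the argument compares units,
  and remains valid when different indices give the same unit.
\<close>
lemma row_lincomb:
  assumes A: "finite A" "A \<subseteq> first_column_units" and c: "c \<in> A \<rightarrow> carrier (group_ring R G)"
    and r: "r \<in> carrier G" "ket_bra R G r \<one>\<^bsub>G\<^esub> \<in> A"
  shows "row (M.lincomb c A) r = c (ket_bra R G r \<one>\<^bsub>G\<^esub>)"
proof -
  let ?B = "ket_bra R G r \<one>\<^bsub>G\<^esub>"
  have A_closed: "B \<in> carrier (group_ring (group_ring R G) G)" if "B \<in> A" for B
    using that A(2) ket_bra_closed by auto
  have "row (M.lincomb c A) r = (\<Oplus>\<^bsub>group_ring R G\<^esub>B\<in>A. row (gr_scalar R G (c B) B) r)"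
    unfolding M.lincomb_def gr_module_simps
    using A_closed c r by (intro row_finsum) (auto intro!: gr_scalar_closed)
  also have "\<dots> = (\<Oplus>\<^bsub>group_ring R G\<^esub>B\<in>A. if ?B = B then c B else \<zero>\<^bsub>group_ring R G\<^esub>)"
  proof (rule V.add.finsum_cong'[OF refl])
    fix B assume B: "B \<in> A"
    have "row B r = (if ?B = B then \<one>\<^bsub>group_ring R G\<^esub> else \<zero>\<^bsub>group_ring R G\<^esub>)"
    proof (cases "?B = B")
      case True
      then show ?thesis
        using r(1) by (auto simp: row_ket_bra)
    next
      case False
      then obtain g where "B = ket_bra R G g \<one>\<^bsub>G\<^esub>" "g \<noteq> r"
        using A(2) B by blast
      with False show ?thesis
        using r(1) by (simp add: row_ket_bra)
    qed
    moreover have "c B \<in> carrier (group_ring R G)"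
      using B c by blast
    ultimately show "row (gr_scalar R G (c B) B) r = (if ?B = B then c B else \<zero>\<^bsub>group_ring R G\<^esub>)"
      using r(1) A_closed[OF B] by (simp add: row_gr_scalar)
  qed (use c in auto)
  also have "\<dots> = c ?B"
    using A c r by (intro V.add.finsum_singleton) auto
  finally show ?thesis .
qed

lemma finite_first_column_units: "finite first_column_units"
  using finite_carrier by simp

lemma lin_indpt_first_column_units: "\<not> M.lin_dep first_column_units"
proof
  assume "M.lin_dep first_column_units"
  then obtain A c B where A: "finite A" "A \<subseteq> first_column_units" "c \<in> A \<rightarrow> carrier (group_ring R G)"
    and zero: "M.lincomb c A = \<zero>\<^bsub>gr_module R G\<^esub>" and B: "B \<in> A" "c B \<noteq> \<zero>\<^bsub>group_ring R G\<^esub>"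
    unfolding M.lin_dep_def by (elim exE conjE) (rule that)
  obtain r where r: "r \<in> carrier G" "B = ket_bra R G r \<one>\<^bsub>G\<^esub>"
    using A(2) B(1) by blast
  then have "c B = row (M.lincomb c A) r"
    using row_lincomb[OF A r(1)] B(1) by simp
  also have "\<dots> = \<zero>\<^bsub>group_ring R G\<^esub>"
    using r by (simp add: zero gr_module_simps row_zero)
  finally show False
    using B by simp
qed

lemma first_column_units_closed:
  "first_column_units \<subseteq> carrier (group_ring (group_ring R G) G)"
  using ket_bra_closed by blast

text \<open>
  Coefficients of a linear combination are attached to units, so taking row \<open>g\<close> of \<open>X\<close> as the
  coefficient of \<open>B\<^sub>g\<close> has to be well defined. Two indices can share a unit only if \<open>1 = 0\<close> in \<open>RG\<close>,
  and then there is only one possible row.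
\<close>
lemma row_eq_if_unit_eq:
  assumes X: "X \<in> carrier (group_ring (group_ring R G) G)"
    and gh: "g \<in> carrier G" "h \<in> carrier G" "ket_bra R G g \<one>\<^bsub>G\<^esub> = ket_bra R G h \<one>\<^bsub>G\<^esub>"
  shows "row X g = row X h"
proof (cases "g = h")
  case False
  then have "\<one>\<^bsub>group_ring R G\<^esub> = \<zero>\<^bsub>group_ring R G\<^esub>"
    using gh row_ket_bra[of g g] row_ket_bra[of g h] by simp
  then have "carrier (group_ring R G) = {\<zero>\<^bsub>group_ring R G\<^esub>}"
    by (rule V.one_zeroD)
  then show ?thesis
    using row_closed[OF X gh(1)] row_closed[OF X gh(2)] by simp
qed simp

text \<open>
  Every \<open>X\<close> is the combination of the \<open>B\<^sub>g\<close> whose coefficients are its own rows.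
\<close>
lemma span_first_column_units:
  "M.span first_column_units = carrier (group_ring (group_ring R G) G)"
proof
  show "M.span first_column_units \<subseteq> carrier (group_ring (group_ring R G) G)"
    using first_column_units_closed by (rule M.span_is_subset2)
next
  show "carrier (group_ring (group_ring R G) G) \<subseteq> M.span first_column_units"
  proof
    fix X assume X: "X \<in> carrier (group_ring (group_ring R G) G)"
    define index where "index B = (SOME g. g \<in> carrier G \<and> ket_bra R G g \<one>\<^bsub>G\<^esub> = B)" for B
    have index: "index B \<in> carrier G \<and> ket_bra R G (index B) \<one>\<^bsub>G\<^esub> = B"
      if "B \<in> first_column_units" for B
    proof -
      have "\<exists>g. g \<in> carrier G \<and> ket_bra R G g \<one>\<^bsub>G\<^esub> = B"
        using that by blast
      then show ?thesis
        unfolding index_def by (rule someI_ex)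
    qed
    define c where "c B = row X (index B)" for B
    have c: "c \<in> first_column_units \<rightarrow> carrier (group_ring R G)"
      unfolding c_def using X index by (intro Pi_I row_closed) blast+
    have "X = M.lincomb c first_column_units"
    proof (rule row_eqI[OF X])
      show "M.lincomb c first_column_units \<in> carrier (group_ring (group_ring R G) G)"
        using c first_column_units_closed by (intro M.lincomb_closed)
      fix r assume r: "r \<in> carrier G"
      then have unit: "ket_bra R G r \<one>\<^bsub>G\<^esub> \<in> first_column_units"
        by blast
      have "row X r = c (ket_bra R G r \<one>\<^bsub>G\<^esub>)"
        unfolding c_def using X r index[OF unit] by (intro row_eq_if_unit_eq) simp_all
      then show "row X r = row (M.lincomb c first_column_units) r"
        using row_lincomb[OF finite_first_column_units order_refl c r unit] by simp
    qed
    then show "X \<in> M.span first_column_units"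
      unfolding M.span_def using finite_first_column_units c by blast
  qed
qed

lemma module_basis_first_column_units:
  "module_basis (group_ring R G) (gr_module R G) first_column_units"
  unfolding module_basis_def gr_module_simps
  using first_column_units_closed lin_indpt_first_column_units span_first_column_units by blast

end

theorem theorem4:
  fixes R :: "('r, 'm) ring_scheme" and G :: "('g, 'n) monoid_scheme"
  assumes "comm_group G" and "finite (carrier G)" and "cring R"
  shows "free_module (group_ring R G) (gr_module R G) \<and>
         module_basis (group_ring R G) (gr_module R G) {ket_bra R G g \<one>\<^bsub>G\<^esub> | g. g \<in> carrier G}"
proof -
  interpret finite_comm_group_ring R G
    using assms by (intro finite_comm_group_ring.intro finite_comm_group_ring_axioms.intro)
  show ?thesis
    unfolding free_module_def
    using module_gr_module module_basis_first_column_units by blast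
qed

end
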